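(* Let $G$ be a group endowed with a left-invariant Boolean ideal $\mathcal I$ such that $\widehat{\mathsf{is}}_{12}(B)=0$ for all $B\in\mathcal I$. If a set $A\subset G$ has positive density $\mathsf{is}_{12}(A)>0$, then for every sequence $(x_i)_{i=1}^n$ of length $n>1/\mathsf{is}_{12}(A)$ in $G$ there are two numbers $k,m\in\{1,\dots,n\}$ with $k<m$ such that $x_{k+1}\cdots x_m\in\Delta_{\mathcal I}(A)$. Consequently, $\Delta_{\mathcal I}(A)$ is an $\mathrm{IP}^*$-set.
   Context: A Boolean ideal on $G$ is a non-empty family $\mathcal I$ of subsets of $G$ such that $A\cup B\in\mathcal I$ and $A\cap C\in\mathcal I$ for all $A,B\in\mathcal I$, $C\subset G$; it is left-invariant if $gA\in\mathcal I$ for all $A\in\mathcal I$, $g\in G$. Put $\Delta_{\mathcal I}(A)=\{x\in G:A\cap xA\notin\mathcal I\}$. A subset $D$ of $G$ is an $\mathrm{IP}^*$-set if for any sequence $(x_n)_{n\in\omega}$ in $G$ there are $k\ge1$ and indices $i_1<i_2<\dots<i_k$ such that $x_{i_1}x_{i_2}\cdots x_{i_k}\in D$. $P_\omega(G)$ denotes the set of finitely supported probability measures on $G$ (finite convex combinations of Dirac measures), with convolution $\big(\sum_i\alpha_i\delta_{a_i}\big)*\big(\sum_j\beta_j\delta_{b_j}\big)=\sum_{i,j}\alpha_i\beta_j\delta_{a_ib_j}$. For $A\subset G$, $\mathsf{is}_{12}(A)=\inf_{\mu_1\in P_\omega(G)}\sup_{\mu_2\in P_\omega(G)}\mu_1*\mu_2(A)$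 and $\widehat{\mathsf{is}}_{12}(A)=\sup_{B\subset G}\big(\mathsf{is}_{12}(A\cup B)-\mathsf{is}_{12}(B)\big)$. *)

theory Defs
  imports "HOL-Algebra.Coset" "HOL-Probability.Probability_Mass_Function"
begin

definition boolean_ideal :: "('a, 'b) monoid_scheme \<Rightarrow> 'a set set \<Rightarrow> bool" where
  "boolean_ideal G I \<longleftrightarrow>
     I \<subseteq> Pow (carrier G) \<and> I \<noteq> {} \<and>
     (\<forall>A\<in>I. \<forall>B\<in>I. A \<union> B \<in> I) \<and>
     (\<forall>A\<in>I. \<forall>C. C \<subseteq> carrier G \<longrightarrow> A \<inter> C \<in> I)"

definition left_invariant :: "('a, 'b) monoid_scheme \<Rightarrow> 'a set set \<Rightarrow> bool" where
  "left_invariant G I \<longleftrightarrow> (\<forall>A\<in>I. \<forall>g\<in>carrier G. g <#\<^bsub>G\<^esub> A \<in> I)"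

definition Delta :: "('a, 'b) monoid_scheme \<Rightarrow> 'a set set \<Rightarrow> 'a set \<Rightarrow> 'a set" where
  "Delta G I A = {x \<in> carrier G. A \<inter> (x <#\<^bsub>G\<^esub> A) \<notin> I}"

text \<open>The ordered product of a list; the group need not be commutative.\<close>

definition list_product :: "('a, 'b) monoid_scheme \<Rightarrow> 'a list \<Rightarrow> 'a" where
  "list_product G xs = foldr (\<otimes>\<^bsub>G\<^esub>) xs \<one>\<^bsub>G\<^esub>"

definition IP_star_set :: "('a, 'b) monoid_scheme \<Rightarrow> 'a set \<Rightarrow> bool" where
  "IP_star_set G D \<longleftrightarrow>
     D \<subseteq> carrier G \<and>
     (\<forall>x :: nat \<Rightarrow> 'a. range x \<subseteq> carrier G \<longrightarrow>
        (\<exists>k\<ge>1. \<exists>i :: nat \<Rightarrow> nat. strict_mono_on {1..k} i \<and>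
           list_product G (map (\<lambda>j. x (i j)) [1..<k + 1]) \<in> D))"

text \<open>
  A finite convex combination of Dirac measures at points of the group is a probability mass
  function whose support is a finite subset of the carrier.
\<close>

definition fin_prob :: "('a, 'b) monoid_scheme \<Rightarrow> 'a pmf set" where
  "fin_prob G = {\<mu>. finite (set_pmf \<mu>) \<and> set_pmf \<mu> \<subseteq> carrier G}"

definition convolution :: "('a, 'b) monoid_scheme \<Rightarrow> 'a pmf \<Rightarrow> 'a pmf \<Rightarrow> 'a pmf" where
  "convolution G \<mu> \<nu> = map_pmf (\<lambda>(a, b). a \<otimes>\<^bsub>G\<^esub> b) (pair_pmf \<mu> \<nu>)"

text \<open>
  The infima and suprema below are conditionally complete ones over the reals. For a nonempty
  carrier all index sets are nonempty, and the values lie in \<open>[0, 1]\<close>, respectively \<open>[-1, 1]\<close>,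
  so they are the genuine ones.
\<close>

definition is12 :: "('a, 'b) monoid_scheme \<Rightarrow> 'a set \<Rightarrow> real" where
  "is12 G A =
     (INF \<mu>\<^sub>1\<in>fin_prob G. SUP \<mu>\<^sub>2\<in>fin_prob G.
        measure_pmf.prob (convolution G \<mu>\<^sub>1 \<mu>\<^sub>2) A)"

definition is12_hat :: "('a, 'b) monoid_scheme \<Rightarrow> 'a set \<Rightarrow> real" where
  "is12_hat G A = (SUP B\<in>Pow (carrier G). is12 G (A \<union> B) - is12 G B)"

end

theory Submission
  imports Defs
begin

text \<open>
  If no product \<open>x\<^bsub>k+1\<^esub> \<dots> x\<^bsub>m\<^esub>\<close> lies in \<open>\<Delta>\<^sub>I(A)\<close>, then the partial products
  \<open>g\<^sub>k = x\<^sub>1 \<dots> x\<^sub>k\<close> give translates \<open>g\<^sub>k A\<close> with pairwise intersections in \<open>I\<close>. Removing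
  a set of \<open>I\<close> from \<open>A\<close> makes these translates disjoint without lowering the density, and
  testing against the uniform measure on the points \<open>g\<^sub>k\<^sup>-\<^sup>1\<close> shows that a set with \<open>n\<close>
  disjoint translates has density at most \<open>1 / n\<close>.
\<close>

lemma prob_bind_pmf_le:
  assumes "\<And>y. y \<in> set_pmf M \<Longrightarrow> measure_pmf.prob (N y) A \<le> c" and "0 \<le> c"
  shows "measure_pmf.prob (bind_pmf M N) A \<le> c"
proof -
  have "emeasure (measure_pmf (bind_pmf M N)) A = (\<integral>\<^sup>+ y. emeasure (N y) A \<partial>measure_pmf M)"
    by simp
  also have "\<dots> \<le> (\<integral>\<^sup>+ y. ennreal c \<partial>measure_pmf M)"
    by (intro nn_integral_mono_AE)
      (auto simp: AE_measure_pmf_iff measure_pmf.emeasure_eq_measure intro!: ennreal_leI assms)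
  also have "\<dots> = ennreal c" by simp
  finally show ?thesis
    using assms(2) by (simp add: measure_pmf.emeasure_eq_measure)
qed

text \<open>Conditioning on the second factor: for \<mu> fixed, the convolution is a mixture over
  \<nu> of right translates of \<mu>. By \<open>prob_bind_pmf_le\<close>, a bound holding at each
  single point y then holds for every \<nu>.\<close>

lemma convolution_eq_bind:
  "convolution G \<mu> \<nu> = bind_pmf \<nu> (\<lambda>y. map_pmf (\<lambda>a. a \<otimes>\<^bsub>G\<^esub> y) \<mu>)"
  unfolding convolution_def pair_pmf_def map_pmf_def
  by (subst (2) bind_commute_pmf) (simp add: bind_assoc_pmf bind_return_pmf)

context group
begin

text \<open>Provides the non-emptiness of \<open>fin_prob G\<close> that the real-valued infima and
  suprema over it require.\<close>

lemma return_pmf_one_fin_prob: "return_pmf \<one> \<in> fin_prob G"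
  by (simp add: fin_prob_def)

lemma SUP_convolution_nonneg:
  "0 \<le> (SUP \<nu>\<in>fin_prob G. measure_pmf.prob (convolution G \<mu> \<nu>) A)"
  by (rule cSUP_upper2[OF _ return_pmf_one_fin_prob]) (auto intro!: bdd_aboveI[where M = 1])

lemma is12_le:
  assumes "\<mu> \<in> fin_prob G"
    and "\<And>\<nu>. \<nu> \<in> fin_prob G \<Longrightarrow> measure_pmf.prob (convolution G \<mu> \<nu>) A \<le> c"
  shows "is12 G A \<le> c"
  unfolding is12_def
proof (rule cINF_lower2[OF _ assms(1)])
  show "(SUP \<nu>\<in>fin_prob G. measure_pmf.prob (convolution G \<mu> \<nu>) A) \<le> c"
    using return_pmf_one_fin_prob by (intro cSUP_least assms(2)) auto
qed (auto intro!: bdd_belowI[where m = 0] SUP_convolution_nonneg)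

lemma is12_nonneg: "0 \<le> is12 G A"
  unfolding is12_def using return_pmf_one_fin_prob
  by (intro cINF_greatest SUP_convolution_nonneg) auto

lemma is12_le_1: "is12 G A \<le> 1"
  by (rule is12_le[OF return_pmf_one_fin_prob]) simp

text \<open>All values of \<open>is12\<close> lie in [0, 1], so the differences in the supremum
  defining \<open>is12_hat\<close> are bounded above and each is dominated by it. When
  \<open>is12_hat G A\<close> vanishes, joining \<open>A\<close> to a set cannot raise its
  density.\<close>

lemma is12_Un_le:
  assumes "B \<subseteq> carrier G"
  shows "is12 G (A \<union> B) \<le> is12_hat G A + is12 G B"
proof -
  have "is12 G (A \<union> C) - is12 G C \<le> 1" for C
    using is12_nonneg[of C] is12_le_1[of "A \<union> C"] by linarith
  then have "is12 G (A \<union> B) - is12 G B \<le> is12_hat G A"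
    unfolding is12_hat_def using assms by (intro cSUP_upper bdd_aboveI2) auto
  then show ?thesis by linarith
qed

text \<open>For a point y, the relation \<open>inv (g k) \<otimes> y \<in> A\<close> means that y
  lies in the translate of \<open>A\<close> by \<open>g k\<close>, and disjointness allows this for
  at most one k. Uniform weights on the points \<open>inv (g k)\<close> therefore give
  \<open>A\<close> mass at most \<open>1 / card K\<close>, wherever the second measure sits.\<close>

lemma is12_le_disjoint_translates:
  assumes "finite K" and "K \<noteq> {}" and g: "\<And>k. k \<in> K \<Longrightarrow> g k \<in> carrier G"
    and A: "A \<subseteq> carrier G" and disj: "disjoint_family_on (\<lambda>k. g k <# A) K"
  shows "is12 G A \<le> 1 / card K"
proof (rule is12_le)
  \<comment> \<open>Uniform on the indices rather than on the points, so coinciding points keep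
    their multiplicity and each k weighs exactly \<open>1 / card K\<close>.\<close>
  define \<mu> where "\<mu> = map_pmf (\<lambda>k. inv (g k)) (pmf_of_set K)"
  show "\<mu> \<in> fin_prob G"
    using assms by (auto simp: \<mu>_def fin_prob_def)
  fix \<nu> assume "\<nu> \<in> fin_prob G"
  then have \<nu>: "set_pmf \<nu> \<subseteq> carrier G" by (simp add: fin_prob_def)
  show "measure_pmf.prob (convolution G \<mu> \<nu>) A \<le> 1 / card K"
    unfolding convolution_eq_bind
  proof (rule prob_bind_pmf_le)
    fix y assume "y \<in> set_pmf \<nu>"
    with \<nu> have y: "y \<in> carrier G" by auto
    let ?S = "K \<inter> {k. inv (g k) \<otimes> y \<in> A}"
    have "y \<in> g k <# A" if "k \<in> ?S" for k
      using that g y by (auto simp: l_coset_def intro!: bexI[of _ "inv (g k) \<otimes> y"] simp flip: m_assoc)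
    with disj have "k = l" if "k \<in> ?S" "l \<in> ?S" for k l
      using that unfolding disjoint_family_on_def by blast
    then have "card ?S \<le> 1"
      using assms(1) by (simp add: card_le_Suc0_iff_eq)
    then show "measure_pmf.prob (map_pmf (\<lambda>a. a \<otimes> y) \<mu>) A \<le> 1 / card K"
      using assms by (simp add: \<mu>_def measure_pmf_of_set vimage_def divide_right_mono)
  qed simp
qed

lemma l_coset_Int:
  assumes "g \<in> carrier G" "A \<subseteq> carrier G" "B \<subseteq> carrier G"
  shows "g <# (A \<inter> B) = (g <# A) \<inter> (g <# B)"
  using assms by (auto simp: l_coset_def subset_eq)

lemma list_product_closed: "set xs \<subseteq> carrier G \<Longrightarrow> list_product G xs \<in> carrier G"
  by (induction xs) (auto simp: list_product_def)

lemma list_product_append: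
  assumes "set xs \<subseteq> carrier G" "set ys \<subseteq> carrier G"
  shows "list_product G (xs @ ys) = list_product G xs \<otimes> list_product G ys"
  using assms(1)
proof (induction xs)
  case Nil
  then show ?case
    using list_product_closed[OF assms(2)] by (simp add: list_product_def)
next
  case (Cons a xs)
  then show ?case
    using list_product_closed[of xs] list_product_closed[OF assms(2)]
    by (simp add: list_product_def m_assoc)
qed

lemma boolean_ideal_UN:
  assumes "boolean_ideal G I" "finite K" "\<And>k. k \<in> K \<Longrightarrow> F k \<in> I"
  shows "(\<Union>k\<in>K. F k) \<in> I"
  using assms(2,3)
proof (induction K)
  case empty
  from assms(1) obtain A where "A \<in> I" by (auto simp: boolean_ideal_def)
  with assms(1) have "A \<inter> {} \<in> I" unfolding boolean_ideal_def by blast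
  then show ?case by simp
next
  case (insert k K)
  then show ?case using assms(1) by (auto simp: boolean_ideal_def)
qed

text \<open>Reduces to disjoint translates by deleting from \<open>A\<close> a finite union of sets
  of the ideal; as these have vanishing \<open>is12_hat\<close>, the density does not drop.\<close>

lemma is12_le_almost_disjoint_translates:
  assumes I: "boolean_ideal G I" "left_invariant G I"
    and null: "\<And>B. B \<in> I \<Longrightarrow> is12_hat G B = 0"
    and K: "finite K" "K \<noteq> {}" and g: "\<And>k. k \<in> K \<Longrightarrow> g k \<in> carrier G"
    and A: "A \<subseteq> carrier G"
    and int: "\<And>k l. k \<in> K \<Longrightarrow> l \<in> K \<Longrightarrow> k \<noteq> l \<Longrightarrow> (g k <# A) \<inter> (g l <# A) \<in> I"
  shows "is12 G A \<le> 1 / card K"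
proof -
  \<comment> \<open>The overlaps are pulled back by \<open>inv (g k)\<close>: \<open>N\<close>
    collects the points of \<open>A\<close> that some \<open>g k\<close> carries into another
    translate. Left invariance keeps each piece in \<open>I\<close>.\<close>
  define N where "N = (\<Union>(k, l)\<in>{(k, l). k \<in> K \<and> l \<in> K \<and> k \<noteq> l}.
    inv (g k) <# ((g k <# A) \<inter> (g l <# A)))"
  have "finite {(k, l). k \<in> K \<and> l \<in> K \<and> k \<noteq> l}"
    by (rule finite_subset[of _ "K \<times> K"]) (use K in auto)
  then have "N \<in> I"
    unfolding N_def using I(2) g int
    by (intro boolean_ideal_UN[OF I(1)]) (auto simp: left_invariant_def)
  then have AN: "N \<inter> A \<in> I"
    using I(1) A by (auto simp: boolean_ideal_def)
  have disj: "disjoint_family_on (\<lambda>k. g k <# (A - N)) K"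
    unfolding disjoint_family_on_def
  proof (intro ballI impI equals0I)
    fix k l z
    assume k: "k \<in> K" and l: "l \<in> K" and "k \<noteq> l"
      and z: "z \<in> (g k <# (A - N)) \<inter> (g l <# (A - N))"
    from z obtain a where a: "a \<in> A" "a \<notin> N" "z = g k \<otimes> a"
      by (auto simp: l_coset_def)
    have "z \<in> (g k <# A) \<inter> (g l <# A)"
      using z by (auto simp: l_coset_def)
    \<comment> \<open>Undoing the translation shows that a point of \<open>A\<close> lying over an
      overlap is one of those collected in \<open>N\<close>.\<close>
    moreover have "a = inv (g k) \<otimes> z"
      using a A g[OF k] by (auto simp flip: m_assoc)
    ultimately have "a \<in> inv (g k) <# ((g k <# A) \<inter> (g l <# A))"
      unfolding l_coset_def by blast
    with k l \<open>k \<noteq> l\<close> have "a \<in> N" by (auto simp: N_def)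
    with a show False by simp
  qed
  have "is12 G A = is12 G ((N \<inter> A) \<union> (A - N))"
    by (rule arg_cong[where f = "is12 G"]) auto
  also have "\<dots> \<le> is12 G (A - N)"
    using is12_Un_le[of "A - N" "N \<inter> A"] null[OF AN] A by auto
  also have "\<dots> \<le> 1 / card K"
    using A by (intro is12_le_disjoint_translates[OF K g _ disj]) auto
  finally show ?thesis .
qed

text \<open>Failure of membership in \<open>Delta G I A\<close> concerns \<open>A\<close> and its
  translate by p; left invariance moves this small intersection along by g.\<close>

lemma Int_translates_in_ideal:
  assumes "left_invariant G I" "g \<in> carrier G" "p \<in> carrier G" "A \<subseteq> carrier G"
    and "p \<notin> Delta G I A"
  shows "(g <# A) \<inter> ((g \<otimes> p) <# A) \<in> I"
proof -
  have "A \<inter> (p <# A) \<in> I"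
    using assms(3,5) by (simp add: Delta_def)
  then have "g <# (A \<inter> (p <# A)) \<in> I"
    using assms(1,2) by (simp add: left_invariant_def)
  then show ?thesis
    using assms by (simp add: l_coset_Int l_coset_subset_G lcos_m_assoc)
qed

lemma consecutive_product_in_Delta:
  assumes I: "boolean_ideal G I" "left_invariant G I"
    and null: "\<And>B. B \<in> I \<Longrightarrow> is12_hat G B = 0"
    and A: "A \<subseteq> carrier G" "is12 G A > 0"
    and n: "real n > 1 / is12 G A" and x: "\<forall>i\<in>{1..n}. x i \<in> carrier G"
  shows "\<exists>k\<in>{1..n}. \<exists>m\<in>{1..n}. k < m \<and>
    list_product G (map x [k + 1..<m + 1]) \<in> Delta G I A"
proof (rule ccontr)
  assume *: "\<not> ?thesis"
  \<comment> \<open>Partial products x_1 ... x_k. With k running over 1, ..., n they index exactly n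
    translates, and the quotient of the m-th by the k-th is x_{k+1} ... x_m.\<close>
  define g where "g k = list_product G (map x [1..<k + 1])" for k
  have closed: "list_product G (map x [k + 1..<m + 1]) \<in> carrier G" if "m \<le> n" for k m
    using that x by (intro list_product_closed) auto
  have g: "g k \<in> carrier G" if "k \<in> {1..n}" for k
    using closed[of k 0] that by (simp add: g_def)
  have int: "(g k <# A) \<inter> (g m <# A) \<in> I" if "k \<in> {1..n}" "m \<in> {1..n}" "k < m" for k m
  proof -
    let ?p = "list_product G (map x [k + 1..<m + 1])"
    have "[1..<m + 1] = [1..<k + 1] @ [k + 1..<m + 1]"
      using that upt_add_eq_append[of 1 "k + 1" "m - k"] by simp
    then have "g m = list_product G (map x [1..<k + 1] @ map x [k + 1..<m + 1])"
      by (simp only: g_def map_append)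
    also have "\<dots> = g k \<otimes> ?p"
      unfolding g_def by (rule list_product_append) (use x that in auto)
    finally have "g m = g k \<otimes> ?p" .
    moreover have "?p \<notin> Delta G I A"
      using that * by blast
    ultimately show ?thesis
      using Int_translates_in_ideal[OF I(2) g closed A(1)] that by (simp del: upt_Suc)
  qed
  \<comment> \<open>Guarantees that the index set of translates is non-empty.\<close>
  have "0 < real n"
    using A(2) n by (meson less_trans zero_less_divide_1_iff)
  have "is12 G A \<le> 1 / card {1..n}"
  proof (rule is12_le_almost_disjoint_translates[OF I null _ _ g A(1)])
    show "(g k <# A) \<inter> (g l <# A) \<in> I" if "k \<in> {1..n}" "l \<in> {1..n}" "k \<noteq> l" for k l
      using int[of k l] int[of l k] that by (cases k l rule: linorder_cases) (auto simp: Int_commute)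
  qed (use \<open>0 < real n\<close> in auto)
  with n A(2) \<open>0 < real n\<close> show False
    by (simp add: field_simps)
qed

end

text \<open>A block of consecutive terms is a special increasing subsequence: the indices are k + j
  for j = 1, ..., m - k.\<close>

lemma IP_star_setI_consecutive:
  assumes "D \<subseteq> carrier G"
    and "\<And>x :: nat \<Rightarrow> 'a. range x \<subseteq> carrier G \<Longrightarrow>
      \<exists>k m. k < m \<and> list_product G (map x [k + 1..<m + 1]) \<in> D"
  shows "IP_star_set G D"
  unfolding IP_star_set_def
proof (intro conjI allI impI)
  fix x :: "nat \<Rightarrow> 'a"
  assume "range x \<subseteq> carrier G"
  with assms(2) obtain k m where km: "k < m" "list_product G (map x [k + 1..<m + 1]) \<in> D"
    by blast
  have "map (\<lambda>j. x (k + j)) [1..<(m - k) + 1] = map x [k + 1..<m + 1]"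
    using km(1) by (intro nth_equalityI) (auto simp del: upt_Suc)
  then show "\<exists>l\<ge>1. \<exists>i :: nat \<Rightarrow> nat. strict_mono_on {1..l} i \<and>
      list_product G (map (\<lambda>j. x (i j)) [1..<l + 1]) \<in> D"
    using km by (intro exI[of _ "m - k"] conjI exI[of _ "\<lambda>j. k + j"])
      (auto simp: strict_mono_on_def simp del: upt_Suc)
qed (fact assms(1))

theorem proposition9p1:
  fixes G :: "('a, 'b) monoid_scheme" and I :: "'a set set" and A :: "'a set"
  assumes "group G"
    and "boolean_ideal G I"
    and "left_invariant G I"
    and "\<And>B. B \<in> I \<Longrightarrow> is12_hat G B = 0"
    and "A \<subseteq> carrier G"
    and "is12 G A > 0"
  shows "(\<forall>n :: nat. \<forall>x :: nat \<Rightarrow> 'a.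
            real n > 1 / is12 G A \<longrightarrow> (\<forall>i\<in>{1..n}. x i \<in> carrier G) \<longrightarrow>
            (\<exists>k\<in>{1..n}. \<exists>m\<in>{1..n}. k < m \<and>
               list_product G (map x [k + 1..<m + 1]) \<in> Delta G I A))
         \<and> IP_star_set G (Delta G I A)"
proof
  note main = group.consecutive_product_in_Delta[OF assms]
  show "\<forall>n :: nat. \<forall>x :: nat \<Rightarrow> 'a.
      real n > 1 / is12 G A \<longrightarrow> (\<forall>i\<in>{1..n}. x i \<in> carrier G) \<longrightarrow>
      (\<exists>k\<in>{1..n}. \<exists>m\<in>{1..n}. k < m \<and>
        list_product G (map x [k + 1..<m + 1]) \<in> Delta G I A)"
    using main by blast
  show "IP_star_set G (Delta G I A)"
  proof (rule IP_star_setI_consecutive)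
    show "Delta G I A \<subseteq> carrier G" by (auto simp: Delta_def)
    fix x :: "nat \<Rightarrow> 'a"
    assume "range x \<subseteq> carrier G"
    then have "\<forall>i\<in>{1..n}. x i \<in> carrier G" for n by auto
    \<comment> \<open>The required length depends only on the density of \<open>A\<close>, so a long
      enough finite stretch x_1, ..., x_n of the infinite sequence suffices.\<close>
    moreover obtain n :: nat where "real n > 1 / is12 G A"
      using reals_Archimedean2 by blast
    ultimately show "\<exists>k m. k < m \<and> list_product G (map x [k + 1..<m + 1]) \<in> Delta G I A"
      using main by blast
  qed
qed

end
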